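(* Let $T$ be a binary tree with $N$ nodes. Then $$\mathbf P_T(\mathbb X)=\prod_{s}\frac{1}{1-q^{n_s}}\begin{cases}q^{n_s}-q^{n'_s}t&\text{if $s$ is the right son of its father},\\ 1-q^{n'_s}t&\text{otherwise},\end{cases}$$ the product running over all nodes $s$ of $T$, where $n_s$ is the number of nodes of the subtree of $T$ rooted at $s$ and $n'_s$ is the number of nodes of the left subtree of $s$.
   Context: Binary trees: each node has an (possibly empty) left and right subtree. For a word $w$ with distinct integer letters, its decreasing binary tree is empty if $w$ is empty, and otherwise has root labelled by the maximal letter $m$, writing $w=w'mw''$, with left subtree the decreasing tree of $w'$ and right subtree that of $w''$. For $\sigma\in\mathfrak S_N$, $P(\sigma)$ denotes the unlabelled shape of the decreasing binary tree of $\sigma^{-1}$ (equivalently the shape of the binary search tree of $\sigma$). For $\mu\in\mathfrak S_N$ and $\epsilon\in\{\pm1\}^N$ let $w=(\epsilon_1\mu_1,\dots,\epsilon_N\mu_N)$, $\mathrm{maj}(\mu,\epsilon)=\sum_{i:\,w_i>w_{i+1}}i$, $m(\epsilon)$ the number of $-1$ entries, $(q)_N=\prod_{i=1}^N(1-q^i)$, and $\mathbf F_\mu(\mathbb X)=\frac1{(q)_N}\sum_{\epsilon}(-t)^{m(\epsilon)}q^{\mathrm{maj}(\mu,\epsilon)}$ (the $(q,t)$-specialization of the free quasi-symmetric function $\mathbf F_\mu$ at $\mathbb X=\frac1{1-q}\hat\times(1-t)$). The Loday–Ronco basis element of $\mathbf{PBT}$ is $\mathbf P_T=\sum_{P(\sigma)=T}\mathbf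 F_\sigma$, so $\mathbf P_T(\mathbb X)=\sum_{\sigma\in\mathfrak S_N,\ P(\sigma)=T}\mathbf F_\sigma(\mathbb X)$. *)

theory Defs
  imports Complex_Main "HOL-Library.Tree" "HOL-Library.FuncSet" "HOL-Combinatorics.Permutations"
begin

function decreasing_tree :: "'a::linorder list \<Rightarrow> 'a tree" where
  "decreasing_tree [] = Leaf"
| "decreasing_tree (x # xs) =
     (let w = x # xs; m = Max (set w)
      in Node (decreasing_tree (takeWhile (\<lambda>y. y \<noteq> m) w)) m
              (decreasing_tree (tl (dropWhile (\<lambda>y. y \<noteq> m) w))))"
  by pat_completeness auto
termination
proof (relation "measure length", goal_cases)
  case 1
  show ?case by simp
next
  case (2 x xs w m)
  have "m \<in> set w"
    using Max_in[of "set w"] 2 by simp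
  then have "takeWhile (\<lambda>y. y \<noteq> m) w \<noteq> w"
    by (metis (mono_tags, lifting) takeWhile_eq_all_conv)
  then have "length (takeWhile (\<lambda>y. y \<noteq> m) w) < length w"
    by (metis (no_types) append_Nil2 takeWhile_dropWhile_id length_append length_greater_0_conv less_add_same_cancel1)
  then show ?case using 2 by simp
next
  case (3 x xs w m)
  have "length (dropWhile (\<lambda>y. y \<noteq> m) w) \<le> length w"
    by (rule length_dropWhile_le)
  then show ?case using 3 by (simp add: less_Suc_eq_le del: dropWhile.simps)
qed

text \<open>A permutation \<open>\<sigma>\<close> of \<open>{1..N}\<close> is identified with the word \<open>\<sigma> 1, \<dots>, \<sigma> N\<close>.
  Unlabelled binary trees are elements of \<^typ>\<open>unit tree\<close>, with \<^const>\<open>Leaf\<close> as the empty tree.\<close>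

definition perm_word :: "nat \<Rightarrow> (nat \<Rightarrow> nat) \<Rightarrow> nat list" where
  "perm_word N \<sigma> = map \<sigma> [1..<Suc N]"

definition P_shape :: "nat \<Rightarrow> (nat \<Rightarrow> nat) \<Rightarrow> unit tree" where
  "P_shape N \<sigma> = map_tree (\<lambda>_. ()) (decreasing_tree (perm_word N (inv \<sigma>)))"

definition sign_vectors :: "nat \<Rightarrow> (nat \<Rightarrow> int) set" where
  "sign_vectors N = {1..N} \<rightarrow>\<^sub>E {1, -1}"

definition signed_maj :: "nat \<Rightarrow> (nat \<Rightarrow> nat) \<Rightarrow> (nat \<Rightarrow> int) \<Rightarrow> nat" where
  "signed_maj N \<mu> \<epsilon> =
     (\<Sum>i | i \<in> {1..<N} \<and> \<epsilon> i * int (\<mu> i) > \<epsilon> (Suc i) * int (\<mu> (Suc i)). i)"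

definition num_neg :: "nat \<Rightarrow> (nat \<Rightarrow> int) \<Rightarrow> nat" where
  "num_neg N \<epsilon> = card {i \<in> {1..N}. \<epsilon> i = -1}"

definition q_poch :: "'a::field \<Rightarrow> nat \<Rightarrow> 'a" where
  "q_poch q N = (\<Prod>i=1..N. 1 - q ^ i)"

definition F_spec :: "'a::field \<Rightarrow> 'a \<Rightarrow> nat \<Rightarrow> (nat \<Rightarrow> nat) \<Rightarrow> 'a" where
  "F_spec q t N \<mu> =
     1 / q_poch q N * (\<Sum>\<epsilon>\<in>sign_vectors N. (- t) ^ num_neg N \<epsilon> * q ^ signed_maj N \<mu> \<epsilon>)"

definition P_spec :: "'a::field \<Rightarrow> 'a \<Rightarrow> unit tree \<Rightarrow> 'a" where
  "P_spec q t T =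
     (\<Sum>\<sigma> | \<sigma> permutes {1..size T} \<and> P_shape (size T) \<sigma> = T. F_spec q t (size T) \<sigma>)"

text \<open>A node is given by the path leading to it from the root.\<close>

datatype dir = L | R

fun subtree_at :: "'a tree \<Rightarrow> dir list \<Rightarrow> 'a tree" where
  "subtree_at T [] = T"
| "subtree_at Leaf (d # p) = Leaf"
| "subtree_at (Node l x r) (L # p) = subtree_at l p"
| "subtree_at (Node l x r) (R # p) = subtree_at r p"

definition tree_nodes :: "'a tree \<Rightarrow> dir list set" where
  "tree_nodes T = {s. subtree_at T s \<noteq> Leaf}"

definition is_right_son :: "dir list \<Rightarrow> bool" where
  "is_right_son s \<longleftrightarrow> s \<noteq> [] \<and> last s = R"

end

theory Submission
  imports Defs
begin

text \<open>
  Label \<open>T\<close> by \<open>1, \<dots>, N\<close> in inorder. Then \<open>P(\<sigma>) = T\<close> holds iff the reversed word of \<open>\<sigma>\<close> is a linear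
  extension of \<open>T\<close> (parents before children). Move the signs from the positions of \<open>\<sigma>\<close> to its
  values, that is, to the nodes of \<open>T\<close>. For fixed signs, the Bjorner-Wachs hook formula says that
  the sum of \<open>q ^ maj\<close> over all linear extensions is \<open>(q)\<^sub>N / \<Prod>\<^sub>s (1 - q ^ n\<^sub>s)\<close> times \<open>q ^ m\<close>, where
  \<open>m\<close> sums \<open>n\<^sub>s\<close> over the nodes \<open>s\<close> whose signed label exceeds that of their father. Inorder
  labelling makes \<open>m\<close> a sum of terms depending on one sign each, so that the sum over
  the signs factorises into the stated product.
\<close>

section \<open>Major index on shuffles of two words\<close>

text \<open>The major index of the reversed word: an ascent contributes the number of letters after it.\<close>

fun rmaj :: "('b \<Rightarrow> 'c::linorder) \<Rightarrow> 'b list \<Rightarrow> nat" where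
  "rmaj s [] = 0"
| "rmaj s (a # w) = (if w \<noteq> [] \<and> s a < s (hd w) then length w else 0) + rmaj s w"

lemma q_poch_0 [simp]: "q_poch q 0 = 1"
  by (simp add: q_poch_def)

lemma q_poch_Suc: "q_poch q (Suc n) = (1 - q ^ Suc n) * q_poch q n"
  by (simp add: q_poch_def mult.commute)

lemma q_poch_nonzero:
  assumes "\<And>i. i \<in> {1..n} \<Longrightarrow> q ^ i \<noteq> 1"
  shows "q_poch q n \<noteq> 0"
  using assms unfolding q_poch_def by (force simp: prod_zero_iff)

text \<open>A shuffle theorem for the major index: the quotient of the \<open>q_poch\<close> terms
  is a q-binomial coefficient, kept multiplied out to avoid division. The induction splits by the
  first letter of the shuffle. The letter \<open>c\<close> in front records the predecessor, which
  decides whether there is an ascent at that place.\<close>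

lemma sum_shuffles_rmaj:
  fixes q :: "'a::field" and s :: "'b \<Rightarrow> 'c::linorder"
  assumes "\<And>a b. a \<in> set u \<Longrightarrow> b \<in> set v \<Longrightarrow> s a \<noteq> s b"
  shows "q_poch q (length u) * q_poch q (length v) * (\<Sum>w\<in>shuffles u v. q ^ rmaj s (c # w)) =
    q_poch q (length u + length v) * q ^ (rmaj s (c # u) + rmaj s (c # v))"
  using assms
proof (induction u v arbitrary: c rule: shuffles.induct)
  case (1 v)
  then show ?case by simp
next
  case (2 a u)
  then show ?case by simp
next
  case (3 a u b v)
  define m where "m = length u"
  define n where "n = length v"
  define U where "U = rmaj s (a # u)"
  define V where "V = rmaj s (b # v)"
  define K where "K = q_poch q (Suc (m + n)) * q ^ (U + V)"
  let ?SA = "\<Sum>w\<in>shuffles u (b # v). q ^ rmaj s (a # w)"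
  let ?SB = "\<Sum>w\<in>shuffles (a # u) v. q ^ rmaj s (b # w)"
  have ab: "s a \<noteq> s b" using 3(3) by simp
  have IHa: "q_poch q m * q_poch q (Suc n) * ?SA = K * q ^ (if s a < s b then Suc n else 0)"
    using 3(1)[of a] 3(3) by (simp add: m_def n_def U_def V_def K_def power_add del: shuffles.simps)
  have IHb: "q_poch q (Suc m) * q_poch q n * ?SB = K * q ^ (if s b < s a then Suc m else 0)"
    using 3(2)[of b] 3(3) by (simp add: m_def n_def U_def V_def K_def power_add del: shuffles.simps)
  have SA: "(\<Sum>w\<in>(#) a ` shuffles u (b # v). q ^ rmaj s (c # w)) =
      q ^ (if s c < s a then Suc (Suc (m + n)) else 0) * ?SA"
    by (subst sum.reindex)
      (auto simp: sum_distrib_left power_add m_def n_def intro!: sum.cong dest!: length_shuffles)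
  have SB: "(\<Sum>w\<in>(#) b ` shuffles (a # u) v. q ^ rmaj s (c # w)) =
      q ^ (if s c < s b then Suc (Suc (m + n)) else 0) * ?SB"
    by (subst sum.reindex)
      (auto simp: sum_distrib_left power_add m_def n_def intro!: sum.cong dest!: length_shuffles)
  have "(\<Sum>w\<in>shuffles (a # u) (b # v). q ^ rmaj s (c # w)) =
      (\<Sum>w\<in>(#) a ` shuffles u (b # v). q ^ rmaj s (c # w)) +
      (\<Sum>w\<in>(#) b ` shuffles (a # u) v. q ^ rmaj s (c # w))"
    unfolding shuffles.simps using ab by (subst sum.union_disjoint) auto
  then have "q_poch q (Suc m) * q_poch q (Suc n) *
       (\<Sum>w\<in>shuffles (a # u) (b # v). q ^ rmaj s (c # w)) =
      q ^ (if s c < s a then Suc (Suc (m + n)) else 0) * (1 - q ^ Suc m) *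
        (q_poch q m * q_poch q (Suc n) * ?SA) +
      q ^ (if s c < s b then Suc (Suc (m + n)) else 0) * (1 - q ^ Suc n) *
        (q_poch q (Suc m) * q_poch q n * ?SB)"
    unfolding SA SB by (simp add: q_poch_Suc algebra_simps del: power_Suc shuffles.simps)
  also have "\<dots> = K * (q ^ (if s c < s a then Suc (Suc (m + n)) else 0) * (1 - q ^ Suc m) *
        q ^ (if s a < s b then Suc n else 0) +
      q ^ (if s c < s b then Suc (Suc (m + n)) else 0) * (1 - q ^ Suc n) *
        q ^ (if s b < s a then Suc m else 0))"
    unfolding IHa IHb by (simp add: algebra_simps)
  \<comment> \<open>For each relative order of the three keys, two of the four terms cancel and the
    other two share the stated power of \<open>q\<close>.\<close>
  also have "\<dots> = K * ((1 - q ^ Suc (Suc (m + n))) *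
      q ^ ((if s c < s a then Suc m else 0) + (if s c < s b then Suc n else 0)))"
    using ab by (cases "s a < s b"; cases "s c < s a"; cases "s c < s b")
      (auto simp: algebra_simps power_add)
  also have "\<dots> = q_poch q (Suc (Suc (m + n))) *
      q ^ (rmaj s (c # a # u) + rmaj s (c # b # v))"
    by (auto simp: K_def U_def V_def m_def n_def q_poch_Suc power_add)
  finally show ?case by (simp add: m_def n_def del: shuffles.simps rmaj.simps)
qed

section \<open>Linear extensions of a tree and the q-hook formula\<close>

fun lin_exts :: "'b tree \<Rightarrow> 'b list set" where
  "lin_exts Leaf = {[]}"
| "lin_exts (Node l x r) = (#) x ` (\<Union>(u, v)\<in>lin_exts l \<times> lin_exts r. shuffles u v)"

text \<open>Designed as the increase of \<open>rmaj\<close> when \<open>x\<close> is put before a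
  word of \<open>lin_exts A\<close>. The guard keeps out the unspecified
  \<open>value Leaf\<close>.\<close>

definition edge_maj :: "('b \<Rightarrow> 'c::linorder) \<Rightarrow> 'b \<Rightarrow> 'b tree \<Rightarrow> nat" where
  "edge_maj s x A = (if A \<noteq> Leaf \<and> s x < s (value A) then size A else 0)"

text \<open>The major index of Bjorner and Wachs for labelled forests, with the hook length of the
  child for each ascending edge.\<close>

fun tree_maj :: "('b \<Rightarrow> 'c::linorder) \<Rightarrow> 'b tree \<Rightarrow> nat" where
  "tree_maj s Leaf = 0"
| "tree_maj s (Node l x r) = edge_maj s x l + edge_maj s x r + tree_maj s l + tree_maj s r"

fun hook_prod :: "'a::field \<Rightarrow> 'b tree \<Rightarrow> 'a" where
  "hook_prod q Leaf = 1"
| "hook_prod q (Node l x r) = (1 - q ^ size (Node l x r)) * hook_prod q l * hook_prod q r"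

lemma finite_lin_exts [simp, intro]: "finite (lin_exts A)"
  by (induction A) auto

lemma set_lin_exts: "w \<in> lin_exts A \<Longrightarrow> set w = set_tree A"
  by (induction A arbitrary: w) (auto dest!: set_shuffles)

lemma length_lin_exts: "w \<in> lin_exts A \<Longrightarrow> length w = size A"
  by (induction A arbitrary: w) (auto dest!: length_shuffles)

lemma distinct_lin_exts:
  assumes "distinct (inorder A)" "w \<in> lin_exts A"
  shows "distinct w"
  using assms
proof (induction A arbitrary: w)
  case (Node l x r)
  from Node.prems(2) obtain u v w'
    where *: "u \<in> lin_exts l" "v \<in> lin_exts r" "w' \<in> shuffles u v" "w = x # w'"
    by auto
  have "distinct w'"
    using Node.IH(1)[OF _ *(1)] Node.IH(2)[OF _ *(2)] set_lin_exts[OF *(1)] set_lin_exts[OF *(2)]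
      Node.prems(1)
    by (intro distinct_disjoint_shuffles[OF _ _ _ *(3)]) auto
  then show ?case
    using set_shuffles[OF *(3)] set_lin_exts[OF *(1)] set_lin_exts[OF *(2)] *(4) Node.prems(1)
    by auto
qed simp

text \<open>Every word of \<open>lin_exts A\<close> begins with the root of \<open>A\<close> and has
  length \<open>size A\<close>, so the ascent in front depends on the tree alone.\<close>

lemma rmaj_Cons_lin_exts:
  "w \<in> lin_exts A \<Longrightarrow> rmaj s (c # w) = edge_maj s c A + rmaj s w"
  by (cases A) (auto simp: edge_maj_def dest!: length_shuffles length_lin_exts)

lemma hook_prod_nonzero:
  assumes "\<And>i. i \<in> {1..size A} \<Longrightarrow> q ^ i \<noteq> 1"
  shows "hook_prod q A \<noteq> 0"
  using assms
proof (induction A)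
  case (Node l x r)
  have "q ^ size (Node l x r) \<noteq> 1" by (rule Node.prems) simp
  moreover have "hook_prod q l \<noteq> 0" "hook_prod q r \<noteq> 0"
    by (rule Node.IH, rule Node.prems, simp)+
  ultimately show ?case by simp
qed simp

text \<open>The \<open>q\<close>-hook formula of Bjorner and Wachs.\<close>

lemma sum_lin_exts_rmaj:
  fixes q :: "'a::field" and s :: "'b \<Rightarrow> 'c::linorder"
  assumes "\<And>i. i \<in> {1..size A} \<Longrightarrow> q ^ i \<noteq> 1" "distinct (inorder A)" "inj_on s (set_tree A)"
  shows "hook_prod q A * (\<Sum>w\<in>lin_exts A. q ^ rmaj s w) = q_poch q (size A) * q ^ tree_maj s A"
  using assms
proof (induction A)
  case (Node l x r)
  let ?m = "size l" and ?n = "size r"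
  let ?S = "\<lambda>A. \<Sum>w\<in>lin_exts A. q ^ rmaj s w"
  have inj: "inj_on s (set_tree l)" "inj_on s (set_tree r)"
    using Node.prems(3) by (auto simp: inj_on_def)
  have IHl: "hook_prod q l * ?S l = q_poch q ?m * q ^ tree_maj s l"
    using Node.prems inj by (intro Node.IH) auto
  have IHr: "hook_prod q r * ?S r = q_poch q ?n * q ^ tree_maj s r"
    using Node.prems inj by (intro Node.IH) auto
  have nz: "q_poch q ?m * q_poch q ?n \<noteq> 0"
    using Node.prems(1) by (auto intro!: q_poch_nonzero)
  have disj: "set u \<inter> set v = {}" if "u \<in> lin_exts l" "v \<in> lin_exts r" for u v
    using that Node.prems(2) by (auto simp: set_lin_exts)
  \<comment> \<open>The root \<open>x\<close> takes the role of the preceding letter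
    \<open>c\<close>: both subtrees are then charged for their edge to \<open>x\<close>.\<close>
  have shuf: "q_poch q ?m * q_poch q ?n * (\<Sum>w\<in>shuffles u v. q ^ rmaj s (x # w)) =
      q_poch q (?m + ?n) * q ^ (edge_maj s x l + edge_maj s x r) * (q ^ rmaj s u * q ^ rmaj s v)"
    if "u \<in> lin_exts l" "v \<in> lin_exts r" for u v
  proof -
    have "s a \<noteq> s b" if "a \<in> set u" "b \<in> set v" for a b
      using that \<open>u \<in> _\<close> \<open>v \<in> _\<close> Node.prems(2,3) disj[OF \<open>u \<in> _\<close> \<open>v \<in> _\<close>]
      by (auto simp: set_lin_exts inj_on_def)
    with sum_shuffles_rmaj[of u v s q x] that show ?thesis
      by (simp add: length_lin_exts rmaj_Cons_lin_exts power_add del: rmaj.simps)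
  qed
  \<comment> \<open>The letters of \<open>l\<close> and \<open>r\<close> are disjoint, so a shuffle
    determines its two constituents by filtering.\<close>
  have dis: "shuffles u v \<inter> shuffles u' v' = {}"
    if "u \<in> lin_exts l" "v \<in> lin_exts r" "u' \<in> lin_exts l" "v' \<in> lin_exts r" "(u, v) \<noteq> (u', v')"
    for u v u' v'
  proof (rule ccontr)
    assume "shuffles u v \<inter> shuffles u' v' \<noteq> {}"
    then obtain w where w: "w \<in> shuffles u v" "w \<in> shuffles u' v'" by blast
    have "set u = set u'" using that set_lin_exts by blast
    then have "u = u'" "v = v'"
      using filter_shuffles_disjoint1[OF disj[OF that(1,2)] w(1)]
        filter_shuffles_disjoint1[OF disj[OF that(3,4)] w(2)] by metis+
    with that(5) show False by simp
  qed
  have "?S (Node l x r) =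
      (\<Sum>w\<in>(\<Union>(u, v)\<in>lin_exts l \<times> lin_exts r. shuffles u v). q ^ rmaj s (x # w))"
    by (simp add: sum.reindex del: rmaj.simps)
  also have "\<dots> = (\<Sum>(u, v)\<in>lin_exts l \<times> lin_exts r. \<Sum>w\<in>shuffles u v. q ^ rmaj s (x # w))"
    using dis by (subst sum.UNION_disjoint) (auto simp: case_prod_beta simp del: rmaj.simps)
  finally have "q_poch q ?m * q_poch q ?n * ?S (Node l x r) =
      (\<Sum>(u, v)\<in>lin_exts l \<times> lin_exts r.
        q_poch q (?m + ?n) * q ^ (edge_maj s x l + edge_maj s x r) * (q ^ rmaj s u * q ^ rmaj s v))"
    using shuf by (auto simp: sum_distrib_left case_prod_beta simp del: rmaj.simps intro!: sum.cong)
  also have "\<dots> = q_poch q (?m + ?n) * q ^ (edge_maj s x l + edge_maj s x r) * (?S l * ?S r)"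
    by (subst sum_product) (simp add: sum.cartesian_product sum_distrib_left case_prod_beta)
  finally have S: "q_poch q ?m * q_poch q ?n * ?S (Node l x r) =
      q_poch q (?m + ?n) * q ^ (edge_maj s x l + edge_maj s x r) * (?S l * ?S r)" .
  \<comment> \<open>The nonzero factor \<open>q_poch q ?m * q_poch q ?n\<close> makes
    \<open>S\<close> applicable and is cancelled at the end.\<close>
  have "q_poch q ?m * q_poch q ?n * (hook_prod q (Node l x r) * ?S (Node l x r)) =
      (1 - q ^ Suc (?m + ?n)) * hook_prod q l * hook_prod q r *
      (q_poch q ?m * q_poch q ?n * ?S (Node l x r))"
    by (simp add: mult_ac del: lin_exts.simps power_Suc)
  also have "\<dots> = (1 - q ^ Suc (?m + ?n)) * q_poch q (?m + ?n) *
      q ^ (edge_maj s x l + edge_maj s x r) * ((hook_prod q l * ?S l) * (hook_prod q r * ?S r))"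
    unfolding S by (simp only: mult_ac)
  also have "\<dots> = q_poch q ?m * q_poch q ?n *
      (q_poch q (size (Node l x r)) * q ^ tree_maj s (Node l x r))"
    unfolding IHl IHr by (simp add: q_poch_Suc power_add mult_ac del: power_Suc)
  finally show ?case using nz by (metis mult_left_cancel)
qed simp

section \<open>Decreasing trees and linear extensions\<close>

lemma decreasing_tree_append:
  assumes "\<And>y. y \<in> set a \<union> set b \<Longrightarrow> y < m"
  shows "decreasing_tree (a @ m # b) = Node (decreasing_tree a) m (decreasing_tree b)"
proof -
  have max: "Max (set (a @ m # b)) = m"
    using assms by (intro Max_eqI) (auto intro: less_imp_le)
  have a: "\<forall>y\<in>set a. y \<noteq> m" using assms by auto
  obtain x xs where w: "a @ m # b = x # xs" by (cases "a @ m # b") auto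
  have "decreasing_tree (a @ m # b) =
      Node (decreasing_tree (takeWhile (\<lambda>y. y \<noteq> m) (a @ m # b))) m
        (decreasing_tree (tl (dropWhile (\<lambda>y. y \<noteq> m) (a @ m # b))))"
    unfolding w decreasing_tree.simps max[unfolded w] Let_def ..
  also have "takeWhile (\<lambda>y. y \<noteq> m) (a @ m # b) = a"
    using a by (simp add: takeWhile_append2)
  also have "dropWhile (\<lambda>y. y \<noteq> m) (a @ m # b) = m # b"
    using a by (simp add: dropWhile_append2)
  finally show ?thesis by simp
qed

lemma size_decreasing_tree [simp]: "size (decreasing_tree w) = length w"
proof (induction w rule: decreasing_tree.induct)
  case (2 x xs)
  define m where "m = Max (set (x # xs))"
  define w where "w = x # xs"
  have "m \<in> set w" unfolding m_def w_def by (rule Max_in) auto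
  then have "dropWhile (\<lambda>y. y \<noteq> m) w \<noteq> []" by (simp add: dropWhile_eq_Nil_conv)
  then have "length (dropWhile (\<lambda>y. y \<noteq> m) w) = Suc (length (tl (dropWhile (\<lambda>y. y \<noteq> m) w)))"
    by (metis length_Suc_conv list.collapse)
  moreover have "length w = length (takeWhile (\<lambda>y. y \<noteq> m) w) + length (dropWhile (\<lambda>y. y \<noteq> m) w)"
    by (metis length_append takeWhile_dropWhile_id)
  moreover have "size (decreasing_tree w) = Suc (length (takeWhile (\<lambda>y. y \<noteq> m) w) +
      length (tl (dropWhile (\<lambda>y. y \<noteq> m) w)))"
    using 2[OF refl refl] unfolding w_def m_def decreasing_tree.simps Let_def tree.size by simp
  ultimately have "size (decreasing_tree w) = length w" by linarith
  then show ?case unfolding w_def .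
qed simp

abbreviation shape :: "'b tree \<Rightarrow> unit tree" where
  "shape \<equiv> map_tree (\<lambda>_. ())"

text \<open>Listing the labels by decreasing value of \<open>f\<close> visits parents before their children
  exactly when \<open>f\<close> decreases along the edges.\<close>

lemma lin_exts_iff_shape_decreasing_tree:
  fixes f :: "'b \<Rightarrow> 'c::linorder"
  assumes "distinct (inorder A)" "set u = set_tree A" "sorted_wrt (\<lambda>a b. f b < f a) u"
  shows "u \<in> lin_exts A \<longleftrightarrow> shape (decreasing_tree (map f (inorder A))) = shape A"
  using assms
proof (induction A arbitrary: u)
  case Leaf
  then show ?case by simp
next
  case (Node l x r)
  from Node.prems(2) obtain y u' where u: "u = y # u'" by (cases u) auto
  \<comment> \<open>As \<open>u\<close> is sorted by decreasing \<open>f\<close>, its head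
    \<open>y\<close> is the label with the largest value of \<open>f\<close>.\<close>
  have less: "f z < f y" if "z \<in> set u'" for z using that Node.prems(3) u by simp
  have yu': "y \<notin> set u'" using less by auto
  let ?ul = "filter (\<lambda>z. z \<in> set_tree l) u'" and ?ur = "filter (\<lambda>z. z \<notin> set_tree l) u'"
  have mem: "insert y (set u') = insert x (set_tree l \<union> set_tree r)"
    using Node.prems(2) u by auto
  have root: "y = x" if "shape (decreasing_tree (map f (inorder (Node l x r)))) = shape (Node l x r)"
  proof -
    have "y \<in> set (inorder (Node l x r))" using mem by auto
    then obtain k1 k2 where k: "inorder (Node l x r) = k1 @ y # k2" by (meson split_list)
    have "z \<noteq> y \<and> z \<in> insert y (set u')" if "z \<in> set k1 \<union> set k2" for z
    proof -
      have "z \<in> set (inorder (Node l x r))" using that unfolding k by auto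
      moreover have "z \<noteq> y" using that Node.prems(1) unfolding k by auto
      ultimately show ?thesis using mem by auto
    qed
    then have "decreasing_tree (map f k1 @ f y # map f k2) =
        Node (decreasing_tree (map f k1)) (f y) (decreasing_tree (map f k2))"
      using less by (intro decreasing_tree_append) auto
    with that have "shape (decreasing_tree (map f k1)) = shape l"
      unfolding k by simp
    \<comment> \<open>The number of letters before the maximum is the size of the left subtree, so
      \<open>y\<close> stands at the inorder position of \<open>x\<close>.\<close>
    then have "size (shape (decreasing_tree (map f k1))) = size (shape l)" by simp
    then have "length k1 = length (inorder l)" by simp
    then show ?thesis using k by simp
  qed
  \<comment> \<open>Filtering by the letters of \<open>l\<close> is the only way to write
    \<open>u'\<close> as a shuffle of a word of \<open>l\<close> and a word of \<open>r\<close>,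
    which reduces the claim to the subtrees.\<close>
  have "u \<in> lin_exts (Node l x r) \<longleftrightarrow> y = x \<and> ?ul \<in> lin_exts l \<and> ?ur \<in> lin_exts r"
  proof
    assume "u \<in> lin_exts (Node l x r)"
    then obtain v w where *: "v \<in> lin_exts l" "w \<in> lin_exts r" "u' \<in> shuffles v w" "y = x"
      using u by auto
    then have "set v \<inter> set w = {}" using Node.prems(1) by (simp add: set_lin_exts)
    then show "y = x \<and> ?ul \<in> lin_exts l \<and> ?ur \<in> lin_exts r"
      using filter_shuffles_disjoint1[OF _ *(3)] * by (simp add: set_lin_exts)
  next
    assume "y = x \<and> ?ul \<in> lin_exts l \<and> ?ur \<in> lin_exts r"
    then show "u \<in> lin_exts (Node l x r)"
      using partition_in_shuffles[of u' "\<lambda>z. z \<in> set_tree l"] u by auto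
  qed
  also have "\<dots> \<longleftrightarrow>
      shape (decreasing_tree (map f (inorder (Node l x r)))) = shape (Node l x r)"
  proof (cases "y = x")
    case True
    then have u': "set u' = set_tree l \<union> set_tree r"
      using mem yu' Node.prems(1) by auto
    have "decreasing_tree (map f (inorder l) @ f x # map f (inorder r)) =
        Node (decreasing_tree (map f (inorder l))) (f x) (decreasing_tree (map f (inorder r)))"
      using less True u' by (intro decreasing_tree_append) auto
    moreover have "?ul \<in> lin_exts l \<longleftrightarrow> shape (decreasing_tree (map f (inorder l))) = shape l"
      using Node.prems(1,3) u u' by (intro Node.IH) (auto intro: sorted_wrt_filter)
    moreover have "?ur \<in> lin_exts r \<longleftrightarrow> shape (decreasing_tree (map f (inorder r))) = shape r"
      using Node.prems(1,3) u u' by (intro Node.IH) (auto intro: sorted_wrt_filter)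
    ultimately show ?thesis using True by simp
  next
    case False
    then show ?thesis using root by blast
  qed
  finally show ?case .
qed

section \<open>Inorder labelling and the permutations of a given shape\<close>

text \<open>The argument \<open>k\<close> is the first label. Each subtree gets an interval of
  labels, so the result is a search tree.\<close>

fun inorder_label :: "'b tree \<Rightarrow> nat \<Rightarrow> nat tree" where
  "inorder_label Leaf k = Leaf"
| "inorder_label (Node l x r) k =
    Node (inorder_label l k) (k + size l) (inorder_label r (Suc (k + size l)))"

lemma shape_inorder_label [simp]: "shape (inorder_label A k) = shape A"
  by (induction A arbitrary: k) auto

lemma size_inorder_label [simp]: "size (inorder_label A k) = size A"
  by (induction A arbitrary: k) auto

lemma inorder_inorder_label [simp]: "inorder (inorder_label A k) = [k..<k + size A]"
proof (induction A arbitrary: k)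
  case (Node l x r)
  have "[k..<k + size (Node l x r)] = [k..<k + size l] @ [k + size l..<(k + size l) + Suc (size r)]"
    using upt_add_eq_append[of k "k + size l" "Suc (size r)"] by (simp add: add_ac)
  then show ?case using Node by (simp add: upt_conv_Cons del: upt_Suc)
qed simp

lemma set_inorder_label [simp]: "set_tree (inorder_label A k) = {k..<k + size A}"
  by (metis inorder_inorder_label set_inorder set_upt)

text \<open>Take \<open>f\<close> to be \<open>inv \<sigma>\<close>: the reversed word lists the
  values by decreasing position, and \<open>inv \<sigma>\<close> along the inorder labels spells the
  word of the inverse permutation.\<close>

lemma rev_perm_word_in_lin_exts:
  assumes "\<sigma> permutes {1..size T}"
  shows "rev (perm_word (size T) \<sigma>) \<in> lin_exts (inorder_label T 1) \<longleftrightarrow> P_shape (size T) \<sigma> = T"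
proof -
  let ?A = "inorder_label T 1"
  have "\<sigma> ` {1..<Suc (size T)} = {1..<Suc (size T)}"
    using permutes_image[OF assms] by (simp add: atLeastLessThanSuc_atLeastAtMost)
  then have "set (rev (perm_word (size T) \<sigma>)) = set_tree ?A"
    by (simp add: perm_word_def del: upt_Suc)
  moreover have "sorted_wrt (\<lambda>a b. inv \<sigma> b < inv \<sigma> a) (rev (perm_word (size T) \<sigma>))"
    using permutes_inverses[OF assms]
    by (simp add: perm_word_def sorted_wrt_rev sorted_wrt_map del: upt_Suc)
  ultimately have "rev (perm_word (size T) \<sigma>) \<in> lin_exts ?A \<longleftrightarrow>
      shape (decreasing_tree (map (inv \<sigma>) (inorder ?A))) = shape ?A"
    by (intro lin_exts_iff_shape_decreasing_tree) (auto simp del: upt_Suc)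
  moreover have "shape T = T" by (induction T) auto
  ultimately show ?thesis
    by (simp add: P_shape_def perm_word_def del: upt_Suc)
qed

text \<open>This turns the sum over the sylvester class of \<open>T\<close> into a sum over linear
  extensions.\<close>

lemma bij_betw_rev_perm_word_lin_exts:
  "bij_betw (\<lambda>\<sigma>. rev (perm_word (size T) \<sigma>))
     {\<sigma>. \<sigma> permutes {1..size T} \<and> P_shape (size T) \<sigma> = T} (lin_exts (inorder_label T 1))"
proof (rule bij_betwI')
  fix \<sigma> \<tau>
  assume *: "\<sigma> \<in> {\<sigma>. \<sigma> permutes {1..size T} \<and> P_shape (size T) \<sigma> = T}"
    "\<tau> \<in> {\<sigma>. \<sigma> permutes {1..size T} \<and> P_shape (size T) \<sigma> = T}"
  show "rev (perm_word (size T) \<sigma>) = rev (perm_word (size T) \<tau>) \<longleftrightarrow> \<sigma> = \<tau>"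
  proof
    assume "rev (perm_word (size T) \<sigma>) = rev (perm_word (size T) \<tau>)"
    then have "\<sigma> i = \<tau> i" if "i \<in> {1..size T}" for i
      using that by (simp add: perm_word_def del: upt_Suc)
    then show "\<sigma> = \<tau>"
      using * by (intro ext) (metis (mono_tags, lifting) mem_Collect_eq permutes_not_in)
  qed simp
next
  fix \<sigma>
  assume "\<sigma> \<in> {\<sigma>. \<sigma> permutes {1..size T} \<and> P_shape (size T) \<sigma> = T}"
  then show "rev (perm_word (size T) \<sigma>) \<in> lin_exts (inorder_label T 1)"
    using rev_perm_word_in_lin_exts by blast
next
  fix w
  assume w: "w \<in> lin_exts (inorder_label T 1)"
  define N where "N = size T"
  \<comment> \<open>Positions start at 1 and list indices at 0. Outside \<open>{1..N}\<close> the
    identity is what \<open>permutes\<close> demands.\<close>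
  define \<sigma> where "\<sigma> i = (if i \<in> {1..N} then rev w ! (i - 1) else i)" for i
  have len: "length w = N" using length_lin_exts[OF w] by (simp add: N_def)
  have set: "set w = {1..N}"
    using set_lin_exts[OF w] by (simp add: N_def atLeastLessThanSuc_atLeastAtMost)
  have dist: "distinct w" by (rule distinct_lin_exts[OF _ w]) simp
  have word: "perm_word N \<sigma> = rev w"
    by (rule nth_equalityI) (auto simp: perm_word_def \<sigma>_def len simp del: upt_Suc)
  have "\<sigma> ` {1..N} = {1..N}"
    using arg_cong[OF word, of set] set
    by (simp add: perm_word_def atLeastLessThanSuc_atLeastAtMost del: upt_Suc)
  then have "bij_betw \<sigma> {1..N} {1..N}"
    by (auto simp: bij_betw_def intro: eq_card_imp_inj_on)
  then have "\<sigma> permutes {1..N}"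
    by (rule bij_imp_permutes) (auto simp: \<sigma>_def)
  then show "\<exists>\<sigma>\<in>{\<sigma>. \<sigma> permutes {1..size T} \<and> P_shape (size T) \<sigma> = T}.
      w = rev (perm_word (size T) \<sigma>)"
    using rev_perm_word_in_lin_exts[of \<sigma> T] w word by (intro bexI[of _ \<sigma>]) (auto simp: N_def)
qed

section \<open>Moving signs from positions to values\<close>

text \<open>A descent at position \<open>i\<close> becomes, after reversal, an ascent at a letter
  followed by exactly \<open>i\<close> letters. The signed letter has to be a function
  \<open>s\<close> of the value alone.\<close>

lemma signed_maj_eq_rmaj:
  assumes "\<And>i. i \<in> {1..N} \<Longrightarrow> \<epsilon> i * int (\<sigma> i) = s (\<sigma> i)"
  shows "signed_maj N \<sigma> \<epsilon> = rmaj s (rev (perm_word N \<sigma>))"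
  using assms
proof (induction N)
  case 0
  then show ?case by (simp add: signed_maj_def perm_word_def)
next
  case (Suc N)
  show ?case
  proof (cases "N = 0")
    case True
    then show ?thesis by (simp add: signed_maj_def perm_word_def)
  next
    case False
    define D where "D N = {i \<in> {1..<N}. \<epsilon> (Suc i) * int (\<sigma> (Suc i)) < \<epsilon> i * int (\<sigma> i)}" for N
    have sN: "\<epsilon> N * int (\<sigma> N) = s (\<sigma> N)" "\<epsilon> (Suc N) * int (\<sigma> (Suc N)) = s (\<sigma> (Suc N))"
      using False by (auto intro!: Suc.prems)
    have "D (Suc N) = (if s (\<sigma> (Suc N)) < s (\<sigma> N) then insert N (D N) else D N)"
      using False sN by (auto simp: D_def less_Suc_eq)
    moreover have "N \<notin> D N" "finite (D N)" by (auto simp: D_def)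
    ultimately have "\<Sum>(D (Suc N)) = (if s (\<sigma> (Suc N)) < s (\<sigma> N) then N else 0) + \<Sum>(D N)"
      by simp
    moreover have "rev (perm_word (Suc N) \<sigma>) = \<sigma> (Suc N) # rev (perm_word N \<sigma>)"
      by (simp add: perm_word_def)
    moreover have "rev (perm_word N \<sigma>) \<noteq> []" "hd (rev (perm_word N \<sigma>)) = \<sigma> N"
      "length (rev (perm_word N \<sigma>)) = N"
      using False by (cases N; simp add: perm_word_def)+
    ultimately show ?thesis
      using Suc by (simp add: signed_maj_def D_def)
  qed
qed

text \<open>Composition with \<open>inv \<sigma>\<close> permutes the sign vectors and keeps the
  number of negative signs. Afterwards a sign belongs to a value, that is, to a node of the tree,
  independently of \<open>\<sigma>\<close>.\<close>

lemma sum_sign_vectors_permute: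
  fixes q t :: "'a::field"
  assumes "\<sigma> permutes {1..N}"
  shows "(\<Sum>\<epsilon>\<in>sign_vectors N. (- t) ^ num_neg N \<epsilon> * q ^ signed_maj N \<sigma> \<epsilon>) =
    (\<Sum>\<eta>\<in>sign_vectors N.
       (- t) ^ num_neg N \<eta> * q ^ rmaj (\<lambda>k. \<eta> k * int k) (rev (perm_word N \<sigma>)))"
proof (rule sum.reindex_bij_witness[where i = "\<lambda>\<eta>. restrict (\<eta> \<circ> \<sigma>) {1..N}"
      and j = "\<lambda>\<epsilon>. restrict (\<epsilon> \<circ> inv \<sigma>) {1..N}"])
  note inv = permutes_inv[OF assms]
  note mem = permutes_in_image[OF assms] permutes_in_image[OF inv]
  note inverses = permutes_inverses[OF assms]
  \<comment> \<open>Both sums range over \<open>sign_vectors N\<close>, so one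
    \<open>\<epsilon>\<close> serves for the conditions on both maps. The \<open>restrict\<close>
    keeps the maps extensional.\<close>
  fix \<epsilon>
  assume \<epsilon>: "\<epsilon> \<in> sign_vectors N"
  then have ext: "\<epsilon> i = undefined" if "i \<notin> {1..N}" for i
    using that by (auto simp: sign_vectors_def)
  have vals: "\<epsilon> i \<in> {1, -1}" if "i \<in> {1..N}" for i
    using that \<epsilon> by (auto simp: sign_vectors_def)
  show "restrict (restrict (\<epsilon> \<circ> inv \<sigma>) {1..N} \<circ> \<sigma>) {1..N} = \<epsilon>"
    using mem inverses ext by (auto simp: fun_eq_iff restrict_def)
  show "restrict (restrict (\<epsilon> \<circ> \<sigma>) {1..N} \<circ> inv \<sigma>) {1..N} = \<epsilon>"
    using mem inverses ext by (auto simp: fun_eq_iff restrict_def)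
  show "restrict (\<epsilon> \<circ> inv \<sigma>) {1..N} \<in> sign_vectors N"
    unfolding sign_vectors_def restrict_PiE_iff comp_apply using mem vals by blast
  show "restrict (\<epsilon> \<circ> \<sigma>) {1..N} \<in> sign_vectors N"
    unfolding sign_vectors_def restrict_PiE_iff comp_apply using mem vals by blast
  define \<eta> where "\<eta> = restrict (\<epsilon> \<circ> inv \<sigma>) {1..N}"
  have "{i \<in> {1..N}. \<eta> i = -1} = \<sigma> ` {i \<in> {1..N}. \<epsilon> i = -1}"
  proof (intro equalityI subsetI)
    fix i assume "i \<in> {i \<in> {1..N}. \<eta> i = -1}"
    then show "i \<in> \<sigma> ` {i \<in> {1..N}. \<epsilon> i = -1}"
      using mem inverses by (intro image_eqI[of _ _ "inv \<sigma> i"]) (auto simp: \<eta>_def)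
  next
    fix i assume "i \<in> \<sigma> ` {i \<in> {1..N}. \<epsilon> i = -1}"
    then show "i \<in> {i \<in> {1..N}. \<eta> i = -1}"
      using mem inverses by (auto simp: \<eta>_def)
  qed
  then have "num_neg N \<eta> = num_neg N \<epsilon>"
    unfolding num_neg_def
    by (simp add: card_image[OF inj_on_subset[OF permutes_inj[OF assms] subset_UNIV]])
  moreover have "signed_maj N \<sigma> \<epsilon> = rmaj (\<lambda>k. \<eta> k * int k) (rev (perm_word N \<sigma>))"
    using mem inverses by (intro signed_maj_eq_rmaj) (auto simp: \<eta>_def)
  ultimately show "(- t) ^ num_neg N (restrict (\<epsilon> \<circ> inv \<sigma>) {1..N}) *
      q ^ rmaj (\<lambda>k. restrict (\<epsilon> \<circ> inv \<sigma>) {1..N} k * int k) (rev (perm_word N \<sigma>)) =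
      (- t) ^ num_neg N \<epsilon> * q ^ signed_maj N \<sigma> \<epsilon>"
    unfolding \<eta>_def by simp
qed

section \<open>Factorisation of the sum over the signs\<close>

text \<open>The numerator of the stated product. A recursion into subtrees forgets the father, so
  the flag \<open>b\<close> remembers whether the root is a right son.\<close>

fun node_prod :: "'a::field \<Rightarrow> 'a \<Rightarrow> bool \<Rightarrow> 'b tree \<Rightarrow> 'a" where
  "node_prod q t b Leaf = 1"
| "node_prod q t b (Node l x r) =
    ((if b then q ^ size (Node l x r) else 1) - q ^ size l * t) *
    node_prod q t False l * node_prod q t True r"

text \<open>A left edge is an ascent iff its upper end is negative, a right edge iff its lower end is
  positive. So the weight of a signing is a product of contributions of single nodes; the flag
  \<open>b\<close> says that the root of \<open>A\<close> is itself a right son.\<close>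

lemma signed_tree_weight_factorises:
  fixes q t :: "'a::field" and A :: "nat tree"
  assumes "bst A"
  obtains g where
    "\<And>\<eta>. (\<And>x. x \<in> set_tree A \<Longrightarrow> \<eta> x \<in> {1, -1::int}) \<Longrightarrow>
       (\<Prod>x\<in>set_tree A. if \<eta> x = -1 then - t else 1) *
       q ^ (tree_maj (\<lambda>k. \<eta> k * int k) A + (if b \<and> A \<noteq> Leaf \<and> \<eta> (value A) = 1 then size A else 0)) =
       (\<Prod>x\<in>set_tree A. g x (\<eta> x))"
    "(\<Prod>x\<in>set_tree A. g x 1 + g x (-1)) = node_prod q t b A"
  using assms
proof (induction A arbitrary: b thesis)
  case Leaf
  show ?case by (rule Leaf.prems(1)[of "\<lambda>_ _. 1"]) auto
next
  case (Node l x r)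
  let ?neg = "\<lambda>\<eta> y. if \<eta> y = (-1::int) then - t else 1"
  let ?maj = "\<lambda>\<eta>. tree_maj (\<lambda>k. \<eta> k * int k)"
  from Node.prems(2) have bst: "bst l" "bst r"
    and lx: "\<And>y. y \<in> set_tree l \<Longrightarrow> y < x" and rx: "\<And>y. y \<in> set_tree r \<Longrightarrow> x < y" by auto
  obtain g where g: "\<And>\<eta>. (\<And>x. x \<in> set_tree l \<Longrightarrow> \<eta> x \<in> {1, -1::int}) \<Longrightarrow>
       (\<Prod>x\<in>set_tree l. ?neg \<eta> x) * q ^ ?maj \<eta> l = (\<Prod>x\<in>set_tree l. g x (\<eta> x))"
    "(\<Prod>x\<in>set_tree l. g x 1 + g x (-1)) = node_prod q t False l"
    using Node.IH(1)[of False, OF _ bst(1)] by auto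
  \<comment> \<open>The right edge at \<open>x\<close> is charged to the root of \<open>r\<close>,
    hence the flag \<open>True\<close> here. The left edge is charged to \<open>x\<close> itself,
    hence \<open>False\<close> for \<open>l\<close>.\<close>
  obtain h where h: "\<And>\<eta>. (\<And>x. x \<in> set_tree r \<Longrightarrow> \<eta> x \<in> {1, -1::int}) \<Longrightarrow>
       (\<Prod>x\<in>set_tree r. ?neg \<eta> x) *
       q ^ (?maj \<eta> r + (if r \<noteq> Leaf \<and> \<eta> (value r) = 1 then size r else 0)) =
       (\<Prod>x\<in>set_tree r. h x (\<eta> x))"
    "(\<Prod>x\<in>set_tree r. h x 1 + h x (-1)) = node_prod q t True r"
    using Node.IH(2)[of True, OF _ bst(2)] by auto
  \<comment> \<open>The weight of the root: a positive sign pays for an ascent from the father if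
    the root is a right son, a negative sign gives \<open>- t\<close> and pays for the left
    edge.\<close>
  define k where "k e = (if e = (1::int) then (if b then q ^ size (Node l x r) else 1)
    else - t * q ^ size l)" for e
  \<comment> \<open>By the search tree property, comparison with \<open>x\<close> tells which part a
    label belongs to.\<close>
  define f where "f y = (if y < x then g y else if y = x then k else h y)" for y
  have split: "(\<Prod>y\<in>set_tree (Node l x r). F y) =
      F x * (\<Prod>y\<in>set_tree l. F y) * (\<Prod>y\<in>set_tree r. F y)" for F :: "nat \<Rightarrow> 'a"
  proof -
    have "set_tree l \<inter> set_tree r = {}" "x \<notin> set_tree l \<union> set_tree r"
      using lx rx by (fastforce, blast)
    then show ?thesis by (simp add: prod.union_disjoint)
  qed
  have fl: "f y = g y" if "y \<in> set_tree l" for y using lx[OF that] by (simp add: f_def)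
  have fr: "f y = h y" if "y \<in> set_tree r" for y using rx[OF that] by (simp add: f_def)
  have fx: "f x = k" by (simp add: f_def)
  show ?case
  proof (rule Node.prems(1)[of f])
    fix \<eta>
    assume \<eta>: "\<And>y. y \<in> set_tree (Node l x r) \<Longrightarrow> \<eta> y \<in> {1, -1::int}"
    \<comment> \<open>On each edge the end with the larger label decides the comparison by its sign:
      \<open>x\<close> on the left edge, the child on the right edge.\<close>
    have edge_l: "edge_maj (\<lambda>k. \<eta> k * int k) x l = (if \<eta> x = -1 then size l else 0)"
    proof (cases l)
      case (Node l1 y l2)
      then show ?thesis using \<eta>[of x] \<eta>[of y] lx[of y] by (auto simp: edge_maj_def)
    qed (simp add: edge_maj_def)
    have edge_r: "edge_maj (\<lambda>k. \<eta> k * int k) x r =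
        (if r \<noteq> Leaf \<and> \<eta> (value r) = 1 then size r else 0)"
    proof (cases r)
      case (Node r1 y r2)
      then show ?thesis using \<eta>[of x] \<eta>[of y] rx[of y] by (auto simp: edge_maj_def)
    qed (simp add: edge_maj_def)
    have root: "?neg \<eta> x * q ^ ((if \<eta> x = -1 then size l else 0) +
        (if b \<and> \<eta> x = 1 then size (Node l x r) else 0)) = k (\<eta> x)"
      using \<eta>[of x] by (auto simp: k_def)
    have "(\<Prod>y\<in>set_tree (Node l x r). ?neg \<eta> y) *
        q ^ (?maj \<eta> (Node l x r) + (if b \<and> \<eta> x = 1 then size (Node l x r) else 0)) =
        (?neg \<eta> x * q ^ ((if \<eta> x = -1 then size l else 0) +
          (if b \<and> \<eta> x = 1 then size (Node l x r) else 0))) *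
        ((\<Prod>y\<in>set_tree l. ?neg \<eta> y) * q ^ ?maj \<eta> l) *
        ((\<Prod>y\<in>set_tree r. ?neg \<eta> y) *
          q ^ (?maj \<eta> r + (if r \<noteq> Leaf \<and> \<eta> (value r) = 1 then size r else 0)))"
      unfolding split tree_maj.simps edge_l edge_r by (simp only: power_add mult_ac)
    also have "\<dots> = k (\<eta> x) * (\<Prod>y\<in>set_tree l. g y (\<eta> y)) * (\<Prod>y\<in>set_tree r. h y (\<eta> y))"
      unfolding root using g(1)[of \<eta>] h(1)[of \<eta>] \<eta> by simp
    also have "\<dots> = (\<Prod>y\<in>set_tree (Node l x r). f y (\<eta> y))"
      unfolding split by (simp add: fl fr fx)
    finally show "(\<Prod>y\<in>set_tree (Node l x r). ?neg \<eta> y) *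
        q ^ (?maj \<eta> (Node l x r) + (if b \<and> Node l x r \<noteq> Leaf \<and> \<eta> (value (Node l x r)) = 1
          then size (Node l x r) else 0)) = (\<Prod>y\<in>set_tree (Node l x r). f y (\<eta> y))"
      by (simp only: tree.sel tree.distinct simp_thms)
  next
    show "(\<Prod>y\<in>set_tree (Node l x r). f y 1 + f y (-1)) = node_prod q t b (Node l x r)"
      unfolding split using g(2) h(2) by (simp add: fl fr fx k_def mult.commute)
  qed
qed

text \<open>Since the weight is a product of functions of one sign each, distributivity turns the
  sum over all signings into a product of two-term sums.\<close>

lemma sum_sign_vectors_tree_maj:
  fixes q t :: "'a::field"
  assumes "bst A" "set_tree A = {1..N}"
  shows "(\<Sum>\<eta>\<in>sign_vectors N. (- t) ^ num_neg N \<eta> * q ^ tree_maj (\<lambda>k. \<eta> k * int k) A) =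
    node_prod q t False A"
proof -
  obtain g where g:
    "\<And>\<eta>. (\<And>x. x \<in> {1..N} \<Longrightarrow> \<eta> x \<in> {1, -1::int}) \<Longrightarrow>
       (\<Prod>x\<in>{1..N}. if \<eta> x = -1 then - t else 1) * q ^ tree_maj (\<lambda>k. \<eta> k * int k) A =
       (\<Prod>x\<in>{1..N}. g x (\<eta> x))"
    "(\<Prod>x\<in>{1..N}. g x 1 + g x (-1)) = node_prod q t False A"
    using signed_tree_weight_factorises[OF assms(1), where b = False and q = q and t = t]
    unfolding assms(2) by auto
  have neg: "(- t) ^ num_neg N \<eta> = (\<Prod>x\<in>{1..N}. if \<eta> x = -1 then - t else 1)" for \<eta>
    by (simp add: num_neg_def prod.If_cases Int_def)
  have "(\<Sum>\<eta>\<in>sign_vectors N. (- t) ^ num_neg N \<eta> * q ^ tree_maj (\<lambda>k. \<eta> k * int k) A) =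
      (\<Sum>\<eta>\<in>{1..N} \<rightarrow>\<^sub>E {1, -1}. \<Prod>x\<in>{1..N}. g x (\<eta> x))"
    unfolding sign_vectors_def neg by (intro sum.cong refl g(1)) (auto simp: PiE_iff)
  also have "\<dots> = (\<Prod>x\<in>{1..N}. \<Sum>e\<in>{1, -1}. g x e)"
    by (rule prod_sum_PiE[symmetric]) auto
  finally show ?thesis using g(2) by simp
qed

section \<open>From recursion on trees to the product over nodes\<close>

lemma tree_nodes_Leaf [simp]: "tree_nodes Leaf = {}"
proof -
  have "subtree_at Leaf p = (Leaf :: 'a tree)" for p by (cases p) auto
  then show ?thesis by (simp add: tree_nodes_def)
qed

lemma tree_nodes_Node:
  "tree_nodes (Node l x r) = insert [] ((#) L ` tree_nodes l \<union> (#) R ` tree_nodes r)"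
proof (rule set_eqI)
  fix p
  show "p \<in> tree_nodes (Node l x r) \<longleftrightarrow>
      p \<in> insert [] ((#) L ` tree_nodes l \<union> (#) R ` tree_nodes r)"
  proof (cases p)
    case (Cons d p')
    then show ?thesis by (cases d) (auto simp: tree_nodes_def)
  qed (simp add: tree_nodes_def)
qed

lemma finite_tree_nodes [simp, intro]: "finite (tree_nodes A)"
  by (induction A) (auto simp: tree_nodes_Node)

text \<open>Dropping the first step of a path turns \<open>[L]\<close> and \<open>[R]\<close> into
  the empty path, whose last step is lost; the flag \<open>b\<close> supplies this information in
  the induction.\<close>

lemma prod_tree_nodes:
  fixes q t :: "'a::field"
  shows "(\<Prod>p\<in>tree_nodes A. 1 / (1 - q ^ size (subtree_at A p)) *
      (if (if p = [] then b else last p = R)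
       then q ^ size (subtree_at A p) - q ^ size (left (subtree_at A p)) * t
       else 1 - q ^ size (left (subtree_at A p)) * t)) =
    node_prod q t b A / hook_prod q A"
proof (induction A arbitrary: b)
  case (Node l x r)
  let ?F = "\<lambda>A b p. 1 / (1 - q ^ size (subtree_at A p)) *
      (if (if p = [] then b else last p = R)
       then q ^ size (subtree_at A p) - q ^ size (left (subtree_at A p)) * t
       else 1 - q ^ size (left (subtree_at A p)) * t)"
  have "(\<Prod>p\<in>tree_nodes (Node l x r). ?F (Node l x r) b p) =
      ?F (Node l x r) b [] * ((\<Prod>p\<in>(#) L ` tree_nodes l. ?F (Node l x r) b p) *
      (\<Prod>p\<in>(#) R ` tree_nodes r. ?F (Node l x r) b p))"
    unfolding tree_nodes_Node
    by (subst prod.insert; (subst prod.union_disjoint)?) auto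
  also have "(\<Prod>p\<in>(#) L ` tree_nodes l. ?F (Node l x r) b p) = (\<Prod>p\<in>tree_nodes l. ?F l False p)"
    by (subst prod.reindex) (auto intro!: prod.cong)
  also have "(\<Prod>p\<in>(#) R ` tree_nodes r. ?F (Node l x r) b p) = (\<Prod>p\<in>tree_nodes r. ?F r True p)"
    by (subst prod.reindex) (auto intro!: prod.cong)
  finally show ?case unfolding Node.IH by (simp add: mult_ac)
qed simp

lemma node_prod_shape [simp]: "node_prod q t b (shape A) = node_prod q t b A"
  by (induction A arbitrary: b) auto

lemma hook_prod_shape [simp]: "hook_prod q (shape A) = hook_prod q A"
  by (induction A) auto

section \<open>Assembly of the product formula\<close>

theorem theorem5p2:
  fixes q t :: "'a::field" and T :: "unit tree" and N :: nat
  assumes "size T = N"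
    and "\<And>i. i \<in> {1..N} \<Longrightarrow> q ^ i \<noteq> 1"
  shows "P_spec q t T =
    (\<Prod>s\<in>tree_nodes T.
       1 / (1 - q ^ size (subtree_at T s)) *
       (if is_right_son s
        then q ^ size (subtree_at T s) - q ^ size (left (subtree_at T s)) * t
        else 1 - q ^ size (left (subtree_at T s)) * t))"
proof -
  define A where "A = inorder_label T 1"
  define S where "S = {\<sigma>. \<sigma> permutes {1..N} \<and> P_shape N \<sigma> = T}"
  define key where "key \<eta> k = \<eta> k * int k" for \<eta> k
  have shape: "shape A = T" by (simp add: A_def) (induction T; simp)
  have size: "size A = N" using assms(1) by (simp add: A_def)
  have set: "set_tree A = {1..N}" using assms(1) by (auto simp: A_def)
  have bst: "bst A" by (simp add: A_def bst_iff_sorted_wrt_less del: upt_Suc)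
  have poch: "q_poch q N \<noteq> 0" using assms(2) by (rule q_poch_nonzero)
  have hook: "hook_prod q A \<noteq> 0" using assms(2) size by (intro hook_prod_nonzero) simp
  have exts: "(\<Sum>\<sigma>\<in>S. q ^ rmaj (key \<eta>) (rev (perm_word N \<sigma>))) =
      q_poch q N / hook_prod q A * q ^ tree_maj (key \<eta>) A" if "\<eta> \<in> sign_vectors N" for \<eta>
  proof -
    \<comment> \<open>Signs do not change absolute values, so distinct labels keep distinct keys, as
      the hook formula requires.\<close>
    have "\<bar>key \<eta> k\<bar> = int k" if "k \<in> {1..N}" for k
    proof -
      have "\<eta> k \<in> {1, -1}" using that \<open>\<eta> \<in> _\<close> by (auto simp: sign_vectors_def)
      then show ?thesis by (auto simp: key_def)
    qed
    then have inj: "inj_on (key \<eta>) (set_tree A)"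
      unfolding set by (metis (no_types, lifting) inj_onI of_nat_eq_iff)
    have "(\<Sum>\<sigma>\<in>S. q ^ rmaj (key \<eta>) (rev (perm_word N \<sigma>))) = (\<Sum>w\<in>lin_exts A. q ^ rmaj (key \<eta>) w)"
      using bij_betw_rev_perm_word_lin_exts[of T] assms(1) unfolding S_def A_def
      by (intro sum.reindex_bij_betw) simp
    moreover have "hook_prod q A * (\<Sum>w\<in>lin_exts A. q ^ rmaj (key \<eta>) w) =
        q_poch q N * q ^ tree_maj (key \<eta>) A"
      using sum_lin_exts_rmaj[of A q "key \<eta>"] assms(2) size inj by (simp add: A_def del: upt_Suc)
    ultimately show ?thesis using hook by (simp add: field_simps)
  qed
  have "P_spec q t T = (\<Sum>\<sigma>\<in>S. 1 / q_poch q N * (\<Sum>\<eta>\<in>sign_vectors N.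
      (- t) ^ num_neg N \<eta> * q ^ rmaj (key \<eta>) (rev (perm_word N \<sigma>))))"
    unfolding P_spec_def F_spec_def assms(1) S_def key_def
    by (intro sum.cong refl arg_cong2[of _ _ _ _ "(*)"] sum_sign_vectors_permute) auto
  \<comment> \<open>The sums can be interchanged because the signs now sit on values and their index
    set does not involve \<open>\<sigma>\<close>.\<close>
  also have "\<dots> = 1 / q_poch q N * (\<Sum>\<eta>\<in>sign_vectors N. (- t) ^ num_neg N \<eta> *
      (\<Sum>\<sigma>\<in>S. q ^ rmaj (key \<eta>) (rev (perm_word N \<sigma>))))"
    unfolding sum_distrib_left by (rule sum.swap)
  also have "\<dots> = 1 / q_poch q N * (\<Sum>\<eta>\<in>sign_vectors N.
      q_poch q N / hook_prod q A * ((- t) ^ num_neg N \<eta> * q ^ tree_maj (key \<eta>) A))"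
    by (intro arg_cong[where f = "(*) (1 / q_poch q N)"] sum.cong refl) (simp add: exts)
  also have "\<dots> = 1 / q_poch q N * (q_poch q N / hook_prod q A * node_prod q t False A)"
    unfolding sum_distrib_left[symmetric] key_def sum_sign_vectors_tree_maj[OF bst set] ..
  \<comment> \<open>Both products ignore labels, so the labelled tree \<open>A\<close> can be
    replaced by its shape \<open>T\<close>.\<close>
  also have "\<dots> = node_prod q t False (shape A) / hook_prod q (shape A)" using poch by simp
  also have "\<dots> = node_prod q t False T / hook_prod q T" unfolding shape ..
  finally have "P_spec q t T = node_prod q t False T / hook_prod q T" .
  moreover have "is_right_son p \<longleftrightarrow> (if p = [] then False else last p = R)" for p
    by (simp add: is_right_son_def)
  ultimately show ?thesis by (simp only: prod_tree_nodes)
qed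

end
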